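(* Let $\Omega\subset\mathbb{R}^n$, $n\ge 2$, be an open bounded domain with Lipschitz boundary, let $p\ge 2$ be fixed, and let $\sigma_1,\sigma_2:\overline\Omega\times[0,+\infty)\to\mathbb{R}$ both satisfy hypotheses (H1)–(H5) listed in the context, with this $p$. If $\sigma_1(x,E)\le\sigma_2(x,E)$ for a.e. $x\in\overline\Omega$ and all $E>0$, then $$\mathbb{F}_{\sigma_1}(u_1^f)\le\mathbb{F}_{\sigma_2}(u_2^f)\qquad\forall f\in X_\diamond,$$ where, for $i=1,2$, $u_i^f$ is the minimizer of the Dirichlet Energy $\mathbb{F}_{\sigma_i}$ over $\{u\in W^{1,p}(\Omega):u|_{\partial\Omega}=f\}$.
   Context: Hypotheses on $\sigma:\overline\Omega\times[0,+\infty)\to\mathbb{R}$, for fixed $p\ge2$: (H1) $x\mapsto\sigma(x,E)$ is measurable on $\overline\Omega$ for every $E\ge0$. (H2) $E\in(0,+\infty)\mapsto\sigma(x,E)E$ is strictly increasing for a.e. $x\in\overline\Omega$. (H3) $E\mapsto\sigma(x,E)$ is continuous on $[0,+\infty)$ for a.e. $x\in\overline\Omega$. (H4) There exist positive constants $\overline\sigma\ge\underline\sigma$ and $E_0>0$ such that $\underline\sigma\,(E/E_0)^{p-2}\le\sigma(x,E)\le\overline\sigma\max\{1,(E/E_0)^{p-2}\}$ for a.e. $x\in\overline\Omega$ and all $E>0$. (H5) There exists $c>0$ such that $(\sigma(x,|\mathbf{E}_2|)\mathbf{E}_2-\sigma(x,|\mathbf{E}_1|)\mathbf{E}_1)\cdot(\mathbf{E}_2-\mathbf{E}_1)\ge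 c|\mathbf{E}_2-\mathbf{E}_1|^p$ for a.e. $x\in\overline\Omega$ and all $\mathbf{E}_1,\mathbf{E}_2\in\mathbb{R}^n$. (The constants may depend on $\sigma$.) Boundary data: $W^{1,p}_0(\Omega)$ is the closure of $C^1_0(\Omega)$ in the $W^{1,p}$-norm. $X=W^{1,p}(\Omega)/W^{1,p}_0(\Omega)$ is the trace space, and $X_\diamond$ is the set of elements of $X$ whose trace has zero average on $\partial\Omega$ with respect to the $(n-1)$-dimensional Hausdorff measure. One writes $f\in X_\diamond$ also for a representative $f\in W^{1,p}(\Omega)$ of a class, and $u|_{\partial\Omega}=f$ means $u-f\in W^{1,p}_0(\Omega)$. Dirichlet Energy: $\mathbb{F}_\sigma(u)=\int_\Omega Q_\sigma(x,|\nabla u(x)|)\,dx$ for $u\in W^{1,p}(\Omega)$, with $Q_\sigma(x,E)=\int_0^E\sigma(x,\xi)\xi\,d\xi$. Under (H1)–(H5) its minimizer over $\{u\in W^{1,p}(\Omega): u|_{\partial\Omega}=f\}$ exists and is unique. *)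

theory Defs
  imports "HOL-Analysis.Analysis"
begin

subsection \<open>Lipschitz domains and Hausdorff measure\<close>

text \<open>Near each boundary point, \<open>\<Omega>\<close> is the strict epigraph, in some unit direction \<open>e\<close>, of a
  Lipschitz function on the hyperplane orthogonal to \<open>e\<close>.\<close>

definition lipschitz_boundary :: "'a::euclidean_space set \<Rightarrow> bool" where
  "lipschitz_boundary \<Omega> \<longleftrightarrow>
     (\<forall>z\<in>frontier \<Omega>. \<exists>e r L \<gamma>. norm e = 1 \<and> 0 < r \<and> L-lipschitz_on {y. y \<bullet> e = 0} \<gamma> \<and>
        \<Omega> \<inter> ball z r = {x \<in> ball z r. \<gamma> (x - (x \<bullet> e) *\<^sub>R e) < x \<bullet> e})"

definition bounded_lipschitz_domain :: "'a::euclidean_space set \<Rightarrow> bool" where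
  "bounded_lipschitz_domain \<Omega> \<longleftrightarrow>
     open \<Omega> \<and> connected \<Omega> \<and> \<Omega> \<noteq> {} \<and> bounded \<Omega> \<and> lipschitz_boundary \<Omega>"

text \<open>Normalised so that the \<open>n\<close>-dimensional measure on an \<open>n\<close>-dimensional space is Lebesgue measure.
  Only used for \<open>s > 0\<close>; because of \<open>0 powr 0 = 0\<close> it is not the counting measure for \<open>s = 0\<close>.
  The \<open>bounded\<close> condition is needed since \<open>diameter\<close> is unspecified on unbounded sets.\<close>

definition hausdorff_pre :: "real \<Rightarrow> real \<Rightarrow> 'a::euclidean_space set \<Rightarrow> ennreal" where
  "hausdorff_pre s \<delta> A =
     (INF U \<in> {U :: nat \<Rightarrow> 'a set. A \<subseteq> (\<Union>i. U i) \<and> (\<forall>i. bounded (U i) \<and> diameter (U i) \<le> \<delta>)}.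
        \<Sum>i. ennreal (unit_ball_vol s * (diameter (U i) / 2) powr s))"

definition hausdorff_outer :: "real \<Rightarrow> 'a::euclidean_space set \<Rightarrow> ennreal" where
  "hausdorff_outer s A = (SUP \<delta> \<in> {0<..}. hausdorff_pre s \<delta> A)"

text \<open>\<open>hausdorff_outer s\<close> is a metric outer measure, hence countably additive on Borel sets, so that
  \<open>measure_of\<close> does not fall back to the zero measure.\<close>

definition hausdorff_measure :: "real \<Rightarrow> 'a::euclidean_space measure" where
  "hausdorff_measure s = measure_of UNIV (sets borel) (hausdorff_outer s)"

definition surface_measure :: "'a::euclidean_space set \<Rightarrow> 'a measure" where
  "surface_measure \<Omega> =
     restrict_space (hausdorff_measure (real DIM('a) - 1)) (frontier \<Omega>)"


subsection \<open>Sobolev spaces\<close>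

text \<open>Functions on \<open>\<Omega>\<close> are total functions of which only the values on \<open>\<Omega>\<close> matter; elements of
  \<open>L\<^sup>p\<close> and of the Sobolev spaces are functions, not classes modulo equality almost everywhere.\<close>

definition Lp :: "'a measure \<Rightarrow> real \<Rightarrow> ('a \<Rightarrow> 'b::euclidean_space) set" where
  "Lp M p = {f \<in> borel_measurable M. integrable M (\<lambda>x. norm (f x) powr p)}"

definition C1 :: "('a::euclidean_space \<Rightarrow> real) set" where
  "C1 = {v. \<exists>Dv. (\<forall>x. GDERIV v x :> Dv x) \<and> continuous_on UNIV Dv}"

text \<open>Compactly supported functions on \<open>\<Omega>\<close>, extended by zero.\<close>

definition C1_0 :: "'a::euclidean_space set \<Rightarrow> ('a \<Rightarrow> real) set" where
  "C1_0 \<Omega> = {\<phi> \<in> C1. \<exists>K. compact K \<and> K \<subseteq> \<Omega> \<and> (\<forall>x. x \<notin> K \<longrightarrow> \<phi> x = 0)}"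

definition locally_integrable ::
    "'a::euclidean_space set \<Rightarrow> ('a \<Rightarrow> 'b::euclidean_space) \<Rightarrow> bool" where
  "locally_integrable \<Omega> f \<longleftrightarrow> (\<forall>K. compact K \<and> K \<subseteq> \<Omega> \<longrightarrow> set_integrable lebesgue K f)"

definition has_weak_gradient ::
    "'a::euclidean_space set \<Rightarrow> ('a \<Rightarrow> real) \<Rightarrow> ('a \<Rightarrow> 'a) \<Rightarrow> bool" where
  "has_weak_gradient \<Omega> u g \<longleftrightarrow> locally_integrable \<Omega> u \<and> locally_integrable \<Omega> g \<and>
     (\<forall>\<phi> \<in> C1_0 \<Omega>. \<forall>D\<phi>. (\<forall>x. GDERIV \<phi> x :> D\<phi> x) \<longrightarrow>
        (LINT x|lebesgue_on \<Omega>. u x *\<^sub>R D\<phi> x) = - (LINT x|lebesgue_on \<Omega>. \<phi> x *\<^sub>R g x))"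

text \<open>A version of the weak gradient, which is unique up to null sets.\<close>

definition weak_grad :: "'a::euclidean_space set \<Rightarrow> ('a \<Rightarrow> real) \<Rightarrow> 'a \<Rightarrow> 'a" where
  "weak_grad \<Omega> u = (SOME g. has_weak_gradient \<Omega> u g)"

definition W1p :: "'a::euclidean_space set \<Rightarrow> real \<Rightarrow> ('a \<Rightarrow> real) set" where
  "W1p \<Omega> p = {u. u \<in> Lp (lebesgue_on \<Omega>) p \<and> (\<exists>g. has_weak_gradient \<Omega> u g) \<and>
                 weak_grad \<Omega> u \<in> Lp (lebesgue_on \<Omega>) p}"

definition W1p_norm :: "'a::euclidean_space set \<Rightarrow> real \<Rightarrow> ('a \<Rightarrow> real) \<Rightarrow> real" where
  "W1p_norm \<Omega> p u =
     ((LINT x|lebesgue_on \<Omega>. \<bar>u x\<bar> powr p) +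
      (LINT x|lebesgue_on \<Omega>. norm (weak_grad \<Omega> u x) powr p)) powr (1 / p)"

definition W1p_0 :: "'a::euclidean_space set \<Rightarrow> real \<Rightarrow> ('a \<Rightarrow> real) set" where
  "W1p_0 \<Omega> p = {u \<in> W1p \<Omega> p. \<forall>\<epsilon>>0. \<exists>\<phi>\<in>C1_0 \<Omega>. W1p_norm \<Omega> p (\<lambda>x. u x - \<phi> x) < \<epsilon>}"


subsection \<open>Boundary data\<close>

definition same_boundary_values :: "'a::euclidean_space set \<Rightarrow> real \<Rightarrow> ('a \<Rightarrow> real) rel" where
  "same_boundary_values \<Omega> p =
     {(u, v). u \<in> W1p \<Omega> p \<and> v \<in> W1p \<Omega> p \<and> (\<lambda>x. u x - v x) \<in> W1p_0 \<Omega> p}"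

definition trace_space :: "'a::euclidean_space set \<Rightarrow> real \<Rightarrow> ('a \<Rightarrow> real) set set" where
  "trace_space \<Omega> p = W1p \<Omega> p // same_boundary_values \<Omega> p"

text \<open>The trace operator is the continuous extension of the restriction to the boundary,
  from \<open>C\<^sup>1\<close> functions, which are dense in \<open>W\<^sup>1\<^sup>,\<^sup>p\<close> on Lipschitz domains.\<close>

definition has_trace ::
    "'a::euclidean_space set \<Rightarrow> real \<Rightarrow> ('a \<Rightarrow> real) \<Rightarrow> ('a \<Rightarrow> real) \<Rightarrow> bool" where
  "has_trace \<Omega> p u g \<longleftrightarrow> g \<in> Lp (surface_measure \<Omega>) p \<and>
     (\<exists>v. (\<forall>k::nat. v k \<in> C1) \<and>
        (\<lambda>k. W1p_norm \<Omega> p (\<lambda>x. v k x - u x)) \<longlonglongrightarrow> 0 \<and>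
        (\<lambda>k. \<integral>\<^sup>+x. ennreal (\<bar>v k x - g x\<bar> powr p) \<partial>surface_measure \<Omega>) \<longlonglongrightarrow> 0)"

definition boundary_average :: "'a::euclidean_space set \<Rightarrow> ('a \<Rightarrow> real) \<Rightarrow> real" where
  "boundary_average \<Omega> g =
     (LINT x|surface_measure \<Omega>. g x) / measure (surface_measure \<Omega>) (frontier \<Omega>)"

definition X_diamond :: "'a::euclidean_space set \<Rightarrow> real \<Rightarrow> ('a \<Rightarrow> real) set set" where
  "X_diamond \<Omega> p = {c \<in> trace_space \<Omega> p.
     \<exists>g. (\<forall>u\<in>c. has_trace \<Omega> p u g) \<and> boundary_average \<Omega> g = 0}"


subsection \<open>Conductivities and the Dirichlet energy\<close>

definition conductivity ::
    "'a::euclidean_space set \<Rightarrow> real \<Rightarrow> ('a \<Rightarrow> real \<Rightarrow> real) \<Rightarrow> bool" where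
  "conductivity \<Omega> p \<sigma> \<longleftrightarrow>
     (\<forall>E\<ge>0. (\<lambda>x. \<sigma> x E) \<in> borel_measurable (lebesgue_on (closure \<Omega>))) \<and>
     (AE x in lebesgue_on (closure \<Omega>). strict_mono_on {0<..} (\<lambda>E. \<sigma> x E * E)) \<and>
     (AE x in lebesgue_on (closure \<Omega>). continuous_on {0..} (\<sigma> x)) \<and>
     (\<exists>\<sigma>lo \<sigma>up E0. 0 < \<sigma>lo \<and> \<sigma>lo \<le> \<sigma>up \<and> 0 < E0 \<and>
        (AE x in lebesgue_on (closure \<Omega>). \<forall>E>0.
           \<sigma>lo * (E / E0) powr (p - 2) \<le> \<sigma> x E \<and>
           \<sigma> x E \<le> \<sigma>up * max 1 ((E / E0) powr (p - 2)))) \<and>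
     (\<exists>c>0. AE x in lebesgue_on (closure \<Omega>). \<forall>E1 E2 :: 'a.
        c * norm (E2 - E1) powr p
          \<le> (\<sigma> x (norm E2) *\<^sub>R E2 - \<sigma> x (norm E1) *\<^sub>R E1) \<bullet> (E2 - E1))"

definition Q_density :: "('a \<Rightarrow> real \<Rightarrow> real) \<Rightarrow> 'a \<Rightarrow> real \<Rightarrow> real" where
  "Q_density \<sigma> x E = integral {0..E} (\<lambda>\<xi>. \<sigma> x \<xi> * \<xi>)"

definition dirichlet_energy ::
    "'a::euclidean_space set \<Rightarrow> ('a \<Rightarrow> real \<Rightarrow> real) \<Rightarrow> ('a \<Rightarrow> real) \<Rightarrow> real" where
  "dirichlet_energy \<Omega> \<sigma> u = (LINT x|lebesgue_on \<Omega>. Q_density \<sigma> x (norm (weak_grad \<Omega> u x)))"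

definition with_boundary_data ::
    "'a::euclidean_space set \<Rightarrow> real \<Rightarrow> ('a \<Rightarrow> real) \<Rightarrow> ('a \<Rightarrow> real) set" where
  "with_boundary_data \<Omega> p f = {u \<in> W1p \<Omega> p. (\<lambda>x. u x - f x) \<in> W1p_0 \<Omega> p}"

definition dirichlet_minimizer ::
    "'a::euclidean_space set \<Rightarrow> real \<Rightarrow> ('a \<Rightarrow> real \<Rightarrow> real) \<Rightarrow> ('a \<Rightarrow> real) \<Rightarrow> ('a \<Rightarrow> real) \<Rightarrow> bool"
  where
  "dirichlet_minimizer \<Omega> p \<sigma> f u \<longleftrightarrow>
     is_arg_min (dirichlet_energy \<Omega> \<sigma>) (\<lambda>v. v \<in> with_boundary_data \<Omega> p f) u"

end

theory Submission
  imports Defs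
begin

text \<open>
  Let \<open>u1\<close>, \<open>u2\<close> minimise the energies of \<open>\<sigma>1 \<le> \<sigma>2\<close> for the same boundary data. Since \<open>u2\<close> competes
  against \<open>u1\<close> and the energy densities inherit the order of the conductivities,
  \<open>F\<^sub>1(u1) \<le> F\<^sub>1(u2) \<le> F\<^sub>2(u2)\<close>.

  The second inequality is monotonicity of the integral, and all the analysis lies in justifying it:
  a Bochner integral is \<open>0\<close> when the integrand is not integrable, so the energy densities
  \<open>Q\<^sub>i(x, \<bar>\<nabla>u2(x)\<bar>)\<close> have to be shown integrable. Their size is controlled by the growth bounds,
  which give \<open>0 \<le> Q(x, E) \<le> C (1 + E\<^sup>p)\<close> (lemmas \<open>Q_density_nonneg\<close> and \<open>Q_density_le_powr\<close>),
  and \<open>\<Omega>\<close> is bounded while \<open>\<bar>\<nabla>u2\<bar>\<close> lies in \<open>L\<^sup>p\<close>. Their measurability is a Caratheodory argument: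
  a function that is measurable in \<open>x\<close> and continuous in \<open>E\<close> is jointly measurable, so its
  integral over a range of \<open>E\<close> that depends measurably on \<open>x\<close> is measurable in \<open>x\<close>
  (lemma \<open>borel_measurable_Q_density_AE\<close>).
\<close>

section \<open>Measurability of the energy density\<close>

text \<open>Caratheodory functions are jointly measurable, because rounding the second variable down to
  the grid of mesh \<open>1 / (n + 1)\<close> leaves only countably many measurable slices, and continuity
  recovers the function as \<open>n\<close> grows. Clipping by \<open>max 0\<close> keeps the second variable in the half
  line where continuity is assumed.\<close>

lemma borel_measurable_pair_caratheodory:
  fixes \<phi> :: "'a \<Rightarrow> real \<Rightarrow> real"
  assumes meas: "\<And>t. 0 \<le> t \<Longrightarrow> (\<lambda>x. \<phi> x t) \<in> borel_measurable M"
    and cont: "\<And>x. x \<in> space M \<Longrightarrow> continuous_on {0..} (\<phi> x)"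
  shows "(\<lambda>(x, t). \<phi> x (max 0 t)) \<in> borel_measurable (M \<Otimes>\<^sub>M lborel)"
proof -
  let ?r = "\<lambda>(n::nat) (k::int). max 0 (of_int k / (real n + 1) :: real)"
  have slices: "(\<lambda>z. \<phi> (fst z) (?r n \<lfloor>snd z * (real n + 1)\<rfloor>)) \<in> borel_measurable (M \<Otimes>\<^sub>M lborel)" for n
  proof (rule measurable_compose_countable[where f = "\<lambda>k z. \<phi> (fst z) (?r n k)"])
    show "(\<lambda>z. \<phi> (fst z) (?r n k)) \<in> borel_measurable (M \<Otimes>\<^sub>M lborel)" for k
      by (rule measurable_compose[OF measurable_fst meas]) simp
    show "(\<lambda>z. \<lfloor>snd z * (real n + 1)\<rfloor>) \<in> M \<Otimes>\<^sub>M lborel \<rightarrow>\<^sub>M count_space UNIV"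
      by measurable
  qed
  have limit: "(\<lambda>n. \<phi> (fst z) (?r n \<lfloor>snd z * (real n + 1)\<rfloor>))
      \<longlonglongrightarrow> (case z of (x, t) \<Rightarrow> \<phi> x (max 0 t))" if "z \<in> space (M \<Otimes>\<^sub>M lborel)" for z
  proof -
    from that obtain x t where z: "z = (x, t)" and x: "x \<in> space M"
      by (auto simp: space_pair_measure)
    have "(\<lambda>n. of_int \<lfloor>t * (real n + 1)\<rfloor> / (real n + 1)) \<longlonglongrightarrow> t"
    proof (rule tendsto_sandwich)
      show "(\<lambda>n. t - 1 / (real n + 1)) \<longlonglongrightarrow> t"
        using tendsto_diff[OF tendsto_const[of t] LIMSEQ_inverse_real_of_nat]
        by (simp add: inverse_eq_divide add.commute)
      show "\<forall>\<^sub>F n in sequentially.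
          t - 1 / (real n + 1) \<le> of_int \<lfloor>t * (real n + 1)\<rfloor> / (real n + 1)"
      proof (rule always_eventually, rule allI)
        fix n :: nat
        have "t * (real n + 1) - 1 \<le> of_int \<lfloor>t * (real n + 1)\<rfloor>" by linarith
        then have "(t * (real n + 1) - 1) / (real n + 1)
            \<le> of_int \<lfloor>t * (real n + 1)\<rfloor> / (real n + 1)"
          by (rule divide_right_mono) simp
        then show "t - 1 / (real n + 1) \<le> of_int \<lfloor>t * (real n + 1)\<rfloor> / (real n + 1)"
          by (simp add: diff_divide_distrib)
      qed
      show "\<forall>\<^sub>F n in sequentially. of_int \<lfloor>t * (real n + 1)\<rfloor> / (real n + 1) \<le> t"
        by (rule always_eventually) (auto simp: pos_divide_le_eq)
    qed simp
    then have lim: "(\<lambda>n. ?r n \<lfloor>t * (real n + 1)\<rfloor>) \<longlonglongrightarrow> max 0 t"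
      by (intro tendsto_max tendsto_const)
    have "(\<lambda>n. \<phi> x (?r n \<lfloor>t * (real n + 1)\<rfloor>)) \<longlonglongrightarrow> \<phi> x (max 0 t)"
      by (rule continuous_on_tendsto_compose[OF cont[OF x] lim]) auto
    then show ?thesis
      by (simp add: z)
  qed
  show ?thesis
    using slices limit by (rule borel_measurable_LIMSEQ_metric)
qed

lemma integrable_on_Q_integrand:
  fixes s :: "real \<Rightarrow> real"
  assumes "continuous_on {0..} s"
  shows "(\<lambda>\<xi>. s \<xi> * \<xi>) integrable_on {0..E}"
  by (intro integrable_continuous_interval continuous_intros continuous_on_subset[OF assms]) auto

text \<open>The variable upper end \<open>h x\<close> is moved into an indicator, which turns the density into a
  Lebesgue integral of one jointly measurable function over a fixed space.\<close>

lemma borel_measurable_Q_density: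
  fixes \<sigma> :: "'a \<Rightarrow> real \<Rightarrow> real"
  assumes meas: "\<And>t. 0 \<le> t \<Longrightarrow> (\<lambda>x. \<sigma> x t) \<in> borel_measurable M"
    and cont: "\<And>x. x \<in> space M \<Longrightarrow> continuous_on {0..} (\<sigma> x)"
    and h: "h \<in> borel_measurable M"
  shows "(\<lambda>x. Q_density \<sigma> x (h x)) \<in> borel_measurable M"
proof -
  have joint: "(\<lambda>z. \<sigma> (fst z) (max 0 (snd z))) \<in> borel_measurable (M \<Otimes>\<^sub>M lborel)"
    using borel_measurable_pair_caratheodory[of \<sigma> M] meas cont by (simp add: case_prod_beta')
  define F where
    "F = (\<lambda>x \<xi>. if 0 \<le> \<xi> \<and> \<xi> \<le> h x then \<sigma> x (max 0 \<xi>) * \<xi> else 0)"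
  have "(\<lambda>z. F (fst z) (snd z)) \<in> borel_measurable (M \<Otimes>\<^sub>M lborel)"
    unfolding F_def using h joint by measurable
  then have "case_prod F \<in> borel_measurable (M \<Otimes>\<^sub>M lborel)"
    by (simp add: case_prod_beta')
  then have "(\<lambda>x. LINT \<xi>|lborel. F x \<xi>) \<in> borel_measurable M"
    by (rule lborel.borel_measurable_lebesgue_integral)
  moreover have "Q_density \<sigma> x (h x) = (LINT \<xi>|lborel. F x \<xi>)" if x: "x \<in> space M" for x
  proof -
    have "continuous_on {0..h x} (\<lambda>\<xi>. \<sigma> x \<xi> * \<xi>)"
      by (intro continuous_intros continuous_on_subset[OF cont[OF x]]) auto
    then have "set_integrable lborel {0..h x} (\<lambda>\<xi>. \<sigma> x \<xi> * \<xi>)"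
      by (intro borel_integrable_atLeastAtMost')
    from set_borel_integral_eq_integral(2)[OF this]
    have "Q_density \<sigma> x (h x) = (LINT \<xi>:{0..h x}|lborel. \<sigma> x \<xi> * \<xi>)"
      by (simp add: Q_density_def)
    also have "\<dots> = (LINT \<xi>|lborel. F x \<xi>)"
      unfolding set_lebesgue_integral_def F_def
      by (intro Bochner_Integration.integral_cong) (auto simp: indicator_def)
    finally show ?thesis .
  qed
  ultimately show ?thesis
    by (subst measurable_cong) auto
qed

text \<open>Continuity is only needed almost everywhere: the conductivity may be replaced by \<open>0\<close> on a
  null set, and completeness of Lebesgue measure carries measurability back.\<close>

lemma borel_measurable_Q_density_AE:
  fixes \<sigma> :: "'a::euclidean_space \<Rightarrow> real \<Rightarrow> real"
  assumes S: "S \<in> sets lebesgue"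
    and meas: "\<And>t. 0 \<le> t \<Longrightarrow> (\<lambda>x. \<sigma> x t) \<in> borel_measurable (lebesgue_on S)"
    and cont: "AE x in lebesgue_on S. continuous_on {0..} (\<sigma> x)"
    and h: "h \<in> borel_measurable (lebesgue_on S)"
  shows "(\<lambda>x. Q_density \<sigma> x (h x)) \<in> borel_measurable (lebesgue_on S)"
proof -
  obtain N where N: "\<And>x. x \<in> space (lebesgue_on S) - N \<Longrightarrow> continuous_on {0..} (\<sigma> x)"
    and null: "N \<in> null_sets (lebesgue_on S)"
    using AE_E3[OF cont] by blast
  have [measurable]: "N \<in> sets (lebesgue_on S)" using null by auto
  define \<tau> where "\<tau> = (\<lambda>x E. if x \<in> N then 0 else \<sigma> x E)"
  have "(\<lambda>x. Q_density \<tau> x (h x)) \<in> borel_measurable (lebesgue_on S)"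
  proof (rule borel_measurable_Q_density[OF _ _ h])
    show "(\<lambda>x. \<tau> x t) \<in> borel_measurable (lebesgue_on S)" if "0 \<le> t" for t
      unfolding \<tau>_def using meas[OF that] by measurable
    show "continuous_on {0..} (\<tau> x)" if "x \<in> space (lebesgue_on S)" for x
      using N[of x] that by (cases "x \<in> N") (auto simp: \<tau>_def)
  qed
  then have "(\<lambda>x. if x \<in> S then Q_density \<tau> x (h x) else 0) \<in> borel_measurable lebesgue"
    using S by (simp add: borel_measurable_if)
  moreover have "AE x in lebesgue_on S. Q_density \<tau> x (h x) = Q_density \<sigma> x (h x)"
    using AE_not_in[OF null] by eventually_elim (simp add: Q_density_def \<tau>_def)
  then have "AE x in lebesgue. (if x \<in> S then Q_density \<tau> x (h x) else 0) =
      (if x \<in> S then Q_density \<sigma> x (h x) else 0)"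
    using S by (simp add: AE_restrict_space_iff)
  ultimately have "(\<lambda>x. if x \<in> S then Q_density \<sigma> x (h x) else 0) \<in> borel_measurable lebesgue"
    by (rule borel_measurable_AE)
  then show ?thesis
    using S by (simp add: borel_measurable_if)
qed

section \<open>Size and order of the energy density\<close>

lemma Q_density_nonneg:
  assumes "continuous_on {0..} (\<sigma> x)" and "\<And>\<xi>. 0 < \<xi> \<Longrightarrow> 0 \<le> \<sigma> x \<xi>"
  shows "0 \<le> Q_density \<sigma> x E"
  unfolding Q_density_def
proof (rule integral_nonneg[OF integrable_on_Q_integrand[OF assms(1)]])
  fix \<xi> assume "\<xi> \<in> {0..E}"
  then show "0 \<le> \<sigma> x \<xi> * \<xi>"
    using assms(2)[of \<xi>] by (cases "\<xi> = 0") auto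
qed

lemma Q_density_mono:
  assumes "continuous_on {0..} (\<sigma> x)" and "continuous_on {0..} (\<tau> x)"
    and "\<And>\<xi>. 0 < \<xi> \<Longrightarrow> \<sigma> x \<xi> \<le> \<tau> x \<xi>"
  shows "Q_density \<sigma> x E \<le> Q_density \<tau> x E"
  unfolding Q_density_def
proof (rule integral_le[OF integrable_on_Q_integrand[OF assms(1)]
      integrable_on_Q_integrand[OF assms(2)]])
  fix \<xi> assume "\<xi> \<in> {0..E}"
  then show "\<sigma> x \<xi> * \<xi> \<le> \<tau> x \<xi> * \<xi>"
    using assms(3)[of \<xi>] by (cases "\<xi> = 0") auto
qed

text \<open>The integrand is at most \<open>b E max {1, (E/E0)\<^sup>p\<^sup>-\<^sup>2}\<close> throughout \<open>[0, E]\<close>, whence \<open>Q\<close> is at most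
  \<open>b E\<^sup>2 max {1, (E/E0)\<^sup>p\<^sup>-\<^sup>2}\<close>, which equals \<open>b E\<^sup>2\<close> for \<open>E \<le> E0\<close> and \<open>b E0\<^sup>2 (E/E0)\<^sup>p\<close> beyond.\<close>

lemma Q_density_le_powr:
  assumes cont: "continuous_on {0..} (\<sigma> x)" and p: "2 \<le> p" and E: "0 \<le> E" and E0: "0 < E0"
    and b: "0 \<le> b"
    and upper: "\<And>\<xi>. 0 < \<xi> \<Longrightarrow> \<sigma> x \<xi> \<le> b * max 1 ((\<xi> / E0) powr (p - 2))"
  shows "Q_density \<sigma> x E \<le> b * E0\<^sup>2 * (1 + (E / E0) powr p)"
proof -
  define m where "m = max 1 ((E / E0) powr (p - 2))"
  have m: "1 \<le> m" by (simp add: m_def)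
  have "Q_density \<sigma> x E \<le> integral {0..E} (\<lambda>\<xi>. b * m * E)"
    unfolding Q_density_def
  proof (rule integral_le[OF integrable_on_Q_integrand[OF cont]])
    fix \<xi> assume \<xi>: "\<xi> \<in> {0..E}"
    show "\<sigma> x \<xi> * \<xi> \<le> b * m * E"
    proof (cases "\<xi> = 0")
      case True
      then show ?thesis using b m E by simp
    next
      case False
      then have pos: "0 < \<xi>" using \<xi> by simp
      have "(\<xi> / E0) powr (p - 2) \<le> (E / E0) powr (p - 2)"
        using \<xi> E0 p by (intro powr_mono2) (auto simp: divide_right_mono)
      then have "b * max 1 ((\<xi> / E0) powr (p - 2)) \<le> b * m"
        unfolding m_def by (intro mult_left_mono b) auto
      then have "\<sigma> x \<xi> \<le> b * m" using upper[OF pos] by simp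
      then show ?thesis using \<xi> b m by (intro mult_mono) auto
    qed
  qed auto
  also have "\<dots> = b * (m * E\<^sup>2)"
    using E by (simp add: power2_eq_square)
  also have "m * E\<^sup>2 \<le> E0\<^sup>2 * (1 + (E / E0) powr p)"
  proof (cases "E \<le> E0")
    case True
    have "(E / E0) powr (p - 2) \<le> 1"
      using True E E0 p by (intro powr_le1) auto
    then have "m * E\<^sup>2 = E\<^sup>2" by (simp add: m_def)
    also have "\<dots> \<le> E0\<^sup>2" using True E by (simp add: power_mono)
    also have "\<dots> \<le> E0\<^sup>2 * (1 + (E / E0) powr p)" by (simp add: mult_le_cancel_left1)
    finally show ?thesis .
  next
    case False
    then have "1 \<le> (E / E0) powr (p - 2)"
      using E0 p by (intro ge_one_powr_ge_zero) auto
    then have "m * E\<^sup>2 = E0\<^sup>2 * ((E / E0) powr (p - 2) * (E / E0)\<^sup>2)"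
      using E0 by (simp add: m_def power_divide)
    also have "(E / E0) powr (p - 2) * (E / E0)\<^sup>2 = (E / E0) powr p"
      using False E0 by (simp add: powr_diff)
    also have "E0\<^sup>2 * (E / E0) powr p \<le> E0\<^sup>2 * (1 + (E / E0) powr p)"
      by (intro mult_left_mono) auto
    finally show ?thesis .
  qed
  finally show ?thesis
    using b by (simp add: mult_left_mono mult.assoc)
qed

section \<open>Comparison of energies\<close>

lemma AE_lebesgue_on_subset:
  assumes "AE x in lebesgue_on T. P x" and "S \<subseteq> T" and "S \<in> sets lebesgue" and "T \<in> sets lebesgue"
  shows "AE x in lebesgue_on S. P x"
  using assms by (auto simp: AE_restrict_space_iff elim!: eventually_mono)

lemma integrable_Q_density:
  fixes \<Omega> :: "'a::euclidean_space set"
  assumes \<Omega>: "\<Omega> \<in> lmeasurable" and p: "2 \<le> p" and \<sigma>: "conductivity \<Omega> p \<sigma>"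
    and g: "g \<in> Lp (lebesgue_on \<Omega>) p"
  shows "integrable (lebesgue_on \<Omega>) (\<lambda>x. Q_density \<sigma> x (norm (g x)))"
proof -
  have sets: "\<Omega> \<in> sets lebesgue" "closure \<Omega> \<in> sets lebesgue"
    using \<Omega> by auto
  note AE_sub = AE_lebesgue_on_subset[OF _ closure_subset sets]
  from \<sigma> obtain a b E0 where ab: "0 < a" "a \<le> b" and E0: "0 < E0"
    and growth: "AE x in lebesgue_on (closure \<Omega>). \<forall>E>0.
           a * (E / E0) powr (p - 2) \<le> \<sigma> x E \<and> \<sigma> x E \<le> b * max 1 ((E / E0) powr (p - 2))"
    unfolding conductivity_def by blast
  have cont: "AE x in lebesgue_on \<Omega>. continuous_on {0..} (\<sigma> x)"
    by (rule AE_sub) (use \<sigma> in \<open>simp add: conductivity_def\<close>)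
  have meas: "(\<lambda>x. \<sigma> x t) \<in> borel_measurable (lebesgue_on \<Omega>)" if "0 \<le> t" for t
    by (rule measurable_restrict_mono[OF _ closure_subset])
      (use \<sigma> that in \<open>simp add: conductivity_def\<close>)
  have bounds: "AE x in lebesgue_on \<Omega>. 0 \<le> Q_density \<sigma> x (norm (g x)) \<and>
      Q_density \<sigma> x (norm (g x)) \<le> b * E0\<^sup>2 * (1 + (norm (g x) / E0) powr p)"
    using cont AE_sub[OF growth]
  proof eventually_elim
    case (elim x)
    have "0 \<le> \<sigma> x \<xi>" if "0 < \<xi>" for \<xi>
    proof -
      have "0 \<le> a * (\<xi> / E0) powr (p - 2)" using ab by simp
      then show ?thesis using elim(2) that by force
    qed
    then show ?case
      using elim ab E0 p by (intro conjI Q_density_nonneg Q_density_le_powr) auto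
  qed
  interpret finite_measure "lebesgue_on \<Omega>"
    using \<Omega> by (rule finite_measure_lebesgue_on)
  have "integrable (lebesgue_on \<Omega>) (\<lambda>x. b * E0\<^sup>2 * (1 + norm (g x) powr p / E0 powr p))"
    using g by (simp add: Lp_def)
  then have "integrable (lebesgue_on \<Omega>) (\<lambda>x. b * E0\<^sup>2 * (1 + (norm (g x) / E0) powr p))"
    using E0 by (simp add: powr_divide)
  then show "integrable (lebesgue_on \<Omega>) (\<lambda>x. Q_density \<sigma> x (norm (g x)))"
  proof (rule Bochner_Integration.integrable_bound)
    show "(\<lambda>x. Q_density \<sigma> x (norm (g x))) \<in> borel_measurable (lebesgue_on \<Omega>)"
      using g by (intro borel_measurable_Q_density_AE sets meas cont) (auto simp: Lp_def)
    show "AE x in lebesgue_on \<Omega>. norm (Q_density \<sigma> x (norm (g x)))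
        \<le> norm (b * E0\<^sup>2 * (1 + (norm (g x) / E0) powr p))"
      using bounds by eventually_elim auto
  qed
qed

lemma dirichlet_energy_mono_conductivity:
  assumes \<Omega>: "\<Omega> \<in> lmeasurable" and p: "2 \<le> p"
    and \<sigma>: "conductivity \<Omega> p \<sigma>" and \<tau>: "conductivity \<Omega> p \<tau>"
    and le: "AE x in lebesgue_on (closure \<Omega>). \<forall>E>0. \<sigma> x E \<le> \<tau> x E"
    and u: "u \<in> W1p \<Omega> p"
  shows "dirichlet_energy \<Omega> \<sigma> u \<le> dirichlet_energy \<Omega> \<tau> u"
  unfolding dirichlet_energy_def
proof (rule integral_mono_AE)
  have g: "weak_grad \<Omega> u \<in> Lp (lebesgue_on \<Omega>) p" using u by (simp add: W1p_def)
  show "integrable (lebesgue_on \<Omega>) (\<lambda>x. Q_density \<sigma> x (norm (weak_grad \<Omega> u x)))"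
    and "integrable (lebesgue_on \<Omega>) (\<lambda>x. Q_density \<tau> x (norm (weak_grad \<Omega> u x)))"
    using integrable_Q_density[OF \<Omega> p _ g] \<sigma> \<tau> by auto
  have "AE x in lebesgue_on (closure \<Omega>). continuous_on {0..} (\<sigma> x)"
    and "AE x in lebesgue_on (closure \<Omega>). continuous_on {0..} (\<tau> x)"
    using \<sigma> \<tau> by (auto simp: conductivity_def)
  then have "AE x in lebesgue_on (closure \<Omega>). Q_density \<sigma> x (norm (weak_grad \<Omega> u x))
      \<le> Q_density \<tau> x (norm (weak_grad \<Omega> u x))"
    using le by eventually_elim (auto intro: Q_density_mono)
  then show "AE x in lebesgue_on \<Omega>. Q_density \<sigma> x (norm (weak_grad \<Omega> u x))
      \<le> Q_density \<tau> x (norm (weak_grad \<Omega> u x))"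
    by (rule AE_lebesgue_on_subset[OF _ closure_subset]) (use \<Omega> in auto)
qed

theorem theorem4p1:
  fixes \<Omega> :: "(real ^ 'n) set" and p :: real and \<sigma>1 \<sigma>2 :: "real ^ 'n \<Rightarrow> real \<Rightarrow> real"
  assumes "CARD('n) \<ge> 2"
    and "bounded_lipschitz_domain \<Omega>"
    and "p \<ge> 2"
    and "conductivity \<Omega> p \<sigma>1"
    and "conductivity \<Omega> p \<sigma>2"
    and "AE x in lebesgue_on (closure \<Omega>). \<forall>E>0. \<sigma>1 x E \<le> \<sigma>2 x E"
  shows "\<forall>c \<in> X_diamond \<Omega> p. \<forall>f \<in> c. \<forall>u1 u2.
           dirichlet_minimizer \<Omega> p \<sigma>1 f u1 \<longrightarrow> dirichlet_minimizer \<Omega> p \<sigma>2 f u2 \<longrightarrow>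
             dirichlet_energy \<Omega> \<sigma>1 u1 \<le> dirichlet_energy \<Omega> \<sigma>2 u2"
proof (intro ballI allI impI)
  fix f u1 u2
  assume min1: "dirichlet_minimizer \<Omega> p \<sigma>1 f u1" and min2: "dirichlet_minimizer \<Omega> p \<sigma>2 f u2"
  have \<Omega>: "\<Omega> \<in> lmeasurable"
    using assms(2) by (auto simp: bounded_lipschitz_domain_def intro: lmeasurable_open)
  have u2: "u2 \<in> with_boundary_data \<Omega> p f"
    using min2 by (simp add: dirichlet_minimizer_def is_arg_min_def)
  then have "dirichlet_energy \<Omega> \<sigma>1 u1 \<le> dirichlet_energy \<Omega> \<sigma>1 u2"
    using min1 by (auto simp: dirichlet_minimizer_def is_arg_min_def not_less)
  also have "\<dots> \<le> dirichlet_energy \<Omega> \<sigma>2 u2"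
    using u2 assms(3-6)
    by (intro dirichlet_energy_mono_conductivity[OF \<Omega>]) (auto simp: with_boundary_data_def)
  finally show "dirichlet_energy \<Omega> \<sigma>1 u1 \<le> dirichlet_energy \<Omega> \<sigma>2 u2" .
qed

end
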